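(* Let $n\ge 4$ be given. Then there do not exist homogeneous polynomials $f_1,f_2\in\mathbb{Z}[x_1,\ldots,x_n]$ (of arbitrary degrees, with integer coefficients) such that for every bi-rainbow meander $\mathcal{RM}(\alpha_1,\ldots,\alpha_n)$ (i.e. for all positive integers $\alpha_1,\ldots,\alpha_n$) the number of connected components satisfies $$\mathcal{Z}(\alpha_1,\ldots,\alpha_n)=\gcd\bigl(f_1(\alpha_1,\ldots,\alpha_n),\,f_2(\alpha_1,\ldots,\alpha_n)\bigr).$$
   Context: For positive integers $\alpha_1,\ldots,\alpha_n$ put $\alpha=\sum_{\ell=1}^n\alpha_\ell$. The bi-rainbow meander $\mathcal{RM}(\alpha_1,\ldots,\alpha_n)$ is the planar configuration of arcs with endpoints at the points $1,2,\ldots,2\alpha$ of the horizontal axis, defined as follows. Above the axis there are $n$ rainbow families of nested arcs: with $s_\ell=2\sum_{k<\ell}\alpha_k$, the $\ell$-th family consists of the $\alpha_\ell$ arcs joining $s_\ell+i$ with $s_\ell+2\alpha_\ell+1-i$, $i=1,\ldots,\alpha_\ell$. Below the axis there is one rainbow family of $\alpha$ nested arcs, joining $k$ with $2\alpha+1-k$, $k=1,\ldots,\alpha$. The union of all upper and lower arcs is a disjoint union of closed Jordan curves; $\mathcal{Z}(\alpha_1,\ldots,\alpha_n)$ denotes the number of these curves (connected components). Equivalently, it is the number of orbits on $\{1,\ldots,2\alpha\}$ of the group generated by the two involutions given by the upper and by the lower arcs. *)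

theory Defs
  imports Complex_Main "HOL-Library.Poly_Mapping"
begin

section \<open>Bi-rainbow meanders\<close>

text \<open>The families are indexed by \<open>1, \<dots>, n\<close>; only the values of \<open>a\<close> on \<open>{1..n}\<close> matter.\<close>

definition rainbow_total :: "nat \<Rightarrow> (nat \<Rightarrow> nat) \<Rightarrow> nat" where
  "rainbow_total n a = (\<Sum>l=1..n. a l)"

definition rainbow_shift :: "(nat \<Rightarrow> nat) \<Rightarrow> nat \<Rightarrow> nat" where
  "rainbow_shift a l = 2 * (\<Sum>k=1..<l. a k)"

text \<open>An arc is represented by its pair (left endpoint, right endpoint).\<close>

definition upper_arcs :: "nat \<Rightarrow> (nat \<Rightarrow> nat) \<Rightarrow> (nat \<times> nat) set" where
  "upper_arcs n a =
     {(rainbow_shift a l + i, rainbow_shift a l + 2 * a l + 1 - i) | l i.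
        l \<in> {1..n} \<and> i \<in> {1..a l}}"

definition lower_arcs :: "nat \<Rightarrow> (nat \<Rightarrow> nat) \<Rightarrow> (nat \<times> nat) set" where
  "lower_arcs n a =
     {(k, 2 * rainbow_total n a + 1 - k) | k. k \<in> {1..rainbow_total n a}}"

definition meander_arcs :: "nat \<Rightarrow> (nat \<Rightarrow> nat) \<Rightarrow> (nat \<times> nat) set" where
  "meander_arcs n a = upper_arcs n a \<union> lower_arcs n a"

text \<open>A closed curve of the meander is identified with the set of its points on the axis.
  Two points are on the same curve iff a chain of arcs, each traversed in either direction,
  leads from one to the other. As every point is an endpoint of exactly one upper and one
  lower arc, these sets are the orbits of the group generated by the upper and the lower
  involution.\<close>

definition meander_curves :: "nat \<Rightarrow> (nat \<Rightarrow> nat) \<Rightarrow> nat set set" where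
  "meander_curves n a =
     {1..2 * rainbow_total n a} // (meander_arcs n a \<union> (meander_arcs n a)\<inverse>)\<^sup>*"

definition meander_components :: "nat \<Rightarrow> (nat \<Rightarrow> nat) \<Rightarrow> nat" where
  "meander_components n a = card (meander_curves n a)"

section \<open>Integer polynomials in several variables\<close>

text \<open>A polynomial maps monomials (exponent vectors) to their coefficients.\<close>

type_synonym int_mpoly = "(nat \<Rightarrow>\<^sub>0 nat) \<Rightarrow>\<^sub>0 int"

definition mpolys :: "nat \<Rightarrow> int_mpoly set" where
  "mpolys n = {f. \<forall>m \<in> Poly_Mapping.keys f. Poly_Mapping.keys m \<subseteq> {1..n}}"

definition monom_deg :: "(nat \<Rightarrow>\<^sub>0 nat) \<Rightarrow> nat" where
  "monom_deg m = (\<Sum>i \<in> Poly_Mapping.keys m. Poly_Mapping.lookup m i)"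

text \<open>The zero polynomial counts as homogeneous (of every degree).\<close>

definition homogeneous :: "int_mpoly \<Rightarrow> bool" where
  "homogeneous f \<longleftrightarrow> (\<exists>d. \<forall>m \<in> Poly_Mapping.keys f. monom_deg m = d)"

definition mpoly_eval :: "int_mpoly \<Rightarrow> (nat \<Rightarrow> int) \<Rightarrow> int" where
  "mpoly_eval f x =
     (\<Sum>m \<in> Poly_Mapping.keys f. Poly_Mapping.lookup f m *
        (\<Prod>i \<in> Poly_Mapping.keys m. x i ^ Poly_Mapping.lookup m i))"

end

(* For arbitrary integer polynomials f1 and f2, divisibility of gcd (f1 a) (f2 a) by N depends
   only on the residues of a modulo N.  For n = 4 and N = 3 the number of curves lacks this
   property: the meander of (1, 2, 1, 4) has 3 curves and that of (1, 2, 1, 1) has 2.  Appending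
   a last family as large as all the others together merely prolongs the lower arcs, so it
   preserves the number of curves, and it preserves congruences; hence the obstruction passes
   from n to n + 1. *)
theory Submission
  imports Defs "HOL-Number_Theory.Cong"
begin

section \<open>Counting the classes of a chain relation\<close>

abbreviation chained :: "'a rel \<Rightarrow> 'a rel" where
  "chained r \<equiv> (r \<union> r\<inverse>)\<^sup>*"

lemma equiv_chained: "equiv UNIV (chained r)"
  by (auto intro!: equivI refl_rtrancl trans_rtrancl sym_rtrancl sym_Un_converse)

text \<open>The map \<open>g\<close> retracts \<open>B\<close> onto \<open>A\<close> within
  \<open>s\<close>-classes and turns every \<open>s\<close>-step into an \<open>r\<close>-chain.
  Hence on \<open>A\<close> both relations agree, every \<open>s\<close>-class meets
  \<open>A\<close>, and saturating an \<open>r\<close>-class under \<open>s\<close> is a bijection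
  between the two sets of classes.\<close>

lemma card_quotient_retract:
  assumes "A \<subseteq> B" and "r \<subseteq> chained s"
    and g: "\<And>x. x \<in> B \<Longrightarrow> g x \<in> A \<and> (x, g x) \<in> chained s"
    and fixed: "\<And>x. x \<in> A \<Longrightarrow> g x = x"
    and hom: "\<And>x y. (x, y) \<in> s \<Longrightarrow> (g x, g y) \<in> chained r"
  shows "card (B // chained s) = card (A // chained r)"
proof -
  have "r\<inverse> \<subseteq> chained s"
    using \<open>r \<subseteq> chained s\<close> equiv_chained[of s] by (auto simp: equiv_def dest: symD)
  then have sub: "chained r \<subseteq> chained s"
    using \<open>r \<subseteq> chained s\<close> by (metis Un_least rtrancl_subset_rtrancl)
  have step: "(g x, g y) \<in> chained r" if "(x, y) \<in> s \<union> s\<inverse>" for x y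
    using that hom equiv_chained[of r] by (auto simp: equiv_def dest: symD)
  have hom': "(g x, g y) \<in> chained r" if "(x, y) \<in> chained s" for x y
    using that by induction (auto intro: rtrancl_trans step)
  have iff: "chained s `` {x} = chained s `` {y} \<longleftrightarrow> chained r `` {x} = chained r `` {y}"
    if "x \<in> A" "y \<in> A" for x y
  proof -
    \<comment> \<open>Left to right, \<open>hom'\<close> turns the \<open>s\<close>-chain into an
      \<open>r\<close>-chain between \<open>g x\<close> and \<open>g y\<close>, which are
      \<open>x\<close> and \<open>y\<close> themselves.\<close>
    have "(x, y) \<in> chained s \<longleftrightarrow> (x, y) \<in> chained r"
      using subsetD[OF sub, of "(x, y)"] hom'[of x y] fixed[OF that(1)] fixed[OF that(2)] by auto
    then show ?thesis
      by (simp only: eq_equiv_class_iff[OF equiv_chained UNIV_I UNIV_I])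
  qed
  have "chained s `` {x} = chained s `` {g x}" if "x \<in> B" for x
    using g[OF that] by (intro equiv_class_eq[OF equiv_chained]) simp
  then have s_img: "B // chained s = (\<lambda>x. chained s `` {x}) ` A"
    using g \<open>A \<subseteq> B\<close> unfolding quotient_def by blast
  have r_img: "A // chained r = (\<lambda>x. chained r `` {x}) ` A"
    unfolding quotient_def by blast
  \<comment> \<open>An \<open>r\<close>-class lies inside one \<open>s\<close>-class, so its
    saturation is that \<open>s\<close>-class.\<close>
  have absorb: "chained s `` (chained r `` {x}) = chained s `` {x}" for x
  proof (rule equalityI)
    show "chained s `` (chained r `` {x}) \<subseteq> chained s `` {x}"
      using sub rtrancl_trans[of x _ "s \<union> s\<inverse>"] by blast
  qed blast
  have "inj_on (\<lambda>C. chained s `` C) (A // chained r)"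
    unfolding r_img inj_on_def using iff by (simp add: absorb)
  moreover have "(\<lambda>C. chained s `` C) ` (A // chained r) = B // chained s"
    unfolding r_img s_img by (simp add: image_image absorb)
  ultimately show ?thesis
    by (metis card_image)
qed

text \<open>The case \<open>r = {}\<close>, where all \<open>r\<close>-classes are singletons:
  \<open>g\<close> picks one representative on each curve, and \<open>A\<close> collects
  them.\<close>

lemma card_quotient_representatives:
  assumes "A \<subseteq> B"
    and "\<And>x. x \<in> B \<Longrightarrow> g x \<in> A \<and> (x, g x) \<in> chained s"
    and "\<And>x. x \<in> A \<Longrightarrow> g x = x"
    and "\<And>x y. (x, y) \<in> s \<Longrightarrow> g x = g y"
  shows "card (B // chained s) = card A"
proof -
  have "card (B // chained s) = card (A // chained {})"
    using assms by (intro card_quotient_retract[where g = g]) auto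
  also have "A // chained {} = (\<lambda>x. {x}) ` A"
    by (auto simp: quotient_def)
  finally show ?thesis
    by (simp add: card_image)
qed

section \<open>Appending a family as large as all the others together\<close>

lemma rainbow_total_append:
  "rainbow_total (Suc n) (a(Suc n := t)) = rainbow_total n a + t"
  by (simp add: rainbow_total_def)

lemma rainbow_shift_append: "l \<le> Suc n \<Longrightarrow> rainbow_shift (a(Suc n := t)) l = rainbow_shift a l"
  by (simp add: rainbow_shift_def)

lemma rainbow_shift_Suc: "rainbow_shift a (Suc n) = 2 * rainbow_total n a"
  by (simp add: rainbow_shift_def rainbow_total_def atLeastLessThanSuc_atLeastAtMost)

lemma upper_arcs_UN:
  "upper_arcs n a = (\<Union>l\<in>{1..n}.
     (\<lambda>i. (rainbow_shift a l + i, rainbow_shift a l + 2 * a l + 1 - i)) ` {1..a l})"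
  unfolding upper_arcs_def by blast

lemma upper_arcs_append:
  "upper_arcs (Suc n) (a(Suc n := t)) = upper_arcs n a \<union>
     (\<lambda>i. (2 * rainbow_total n a + i, 2 * rainbow_total n a + 2 * t + 1 - i)) ` {1..t}"
  by (simp add: upper_arcs_UN atLeastAtMostSuc_conv rainbow_shift_append
      rainbow_shift_Suc[symmetric] Un_commute)

lemma upper_arcs_range:
  assumes "(x, y) \<in> upper_arcs n a"
  shows "x \<in> {1..2 * rainbow_total n a} \<and> y \<in> {1..2 * rainbow_total n a}"
proof -
  obtain l i where li: "l \<in> {1..n}" "i \<in> {1..a l}" "x = rainbow_shift a l + i"
    "y = rainbow_shift a l + 2 * a l + 1 - i"
    using assms by (auto simp: upper_arcs_def)
  \<comment> \<open>Twice the total of the first \<open>l\<close> families is the last point of the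
    \<open>l\<close>-th one.\<close>
  have "rainbow_shift a l + 2 * a l = 2 * rainbow_total l a"
    using rainbow_shift_Suc[of a l] li by (simp add: rainbow_shift_def)
  also have "\<dots> \<le> 2 * rainbow_total n a"
    using li by (auto simp: rainbow_total_def intro!: sum_mono2)
  finally show ?thesis
    using li by auto
qed

text \<open>Write t for the old total. A new lower arc reflects \<open>x\<close> to 4t+1-x, an arc
  of the new family sends this to 2t+x, and a second lower arc returns to 2t+1-x. This is the other
  end of the old lower arc at \<open>x\<close>, so each old lower arc is replaced by a path of three
  new arcs.\<close>

lemma meander_components_append_total:
  "meander_components (Suc n) (a(Suc n := rainbow_total n a)) = meander_components n a"
  unfolding meander_components_def meander_curves_def
proof (rule card_quotient_retract)
  let ?t = "rainbow_total n a"
  let ?a = "a(Suc n := ?t)"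
  let ?s = "meander_arcs (Suc n) ?a"
  \<comment> \<open>Points of the new family are pulled back to the old ones along their lower
    arcs.\<close>
  let ?g = "\<lambda>x. if x \<le> 2 * ?t then x else 4 * ?t + 1 - x"
  have total: "rainbow_total (Suc n) ?a = 2 * ?t"
    by (simp add: rainbow_total_append)
  have lower: "(x, y) \<in> ?s" if "x + y = 4 * ?t + 1" "1 \<le> x" "x < y" for x y
    using that by (auto simp: meander_arcs_def lower_arcs_def total)
  have outer: "(x, y) \<in> ?s" if "x + y = 6 * ?t + 1" "2 * ?t < x" "x < y" for x y
  proof -
    have "x = 2 * ?t + (x - 2 * ?t)" "y = 2 * ?t + 2 * ?t + 1 - (x - 2 * ?t)"
      "x - 2 * ?t \<in> {1..?t}"
      using that by auto
    then show ?thesis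
      unfolding meander_arcs_def upper_arcs_append by blast
  qed
  show "{1..2 * ?t} \<subseteq> {1..2 * rainbow_total (Suc n) ?a}"
    by (simp add: total)
  show "meander_arcs n a \<subseteq> chained ?s"
  proof (rule subrelI)
    fix x y assume xy: "(x, y) \<in> meander_arcs n a"
    show "(x, y) \<in> chained ?s"
    proof (cases "(x, y) \<in> upper_arcs n a")
      case True
      then show ?thesis
        by (auto simp: meander_arcs_def upper_arcs_append)
    next
      case False
      \<comment> \<open>The detour from \<open>x\<close> to \<open>y\<close> through 4t+1-x and
        4t+1-y. The middle arc has endpoint sum 6t+1 and is traversed from right to left, because
        \<open>x < y\<close> reverses under reflection.\<close>
      then have "x + y = 2 * ?t + 1" "1 \<le> x" "x < y" "y \<le> 2 * ?t"
        using xy by (auto simp: meander_arcs_def lower_arcs_def)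
      then have "(x, 4 * ?t + 1 - x) \<in> ?s" "(4 * ?t + 1 - y, 4 * ?t + 1 - x) \<in> ?s"
        "(y, 4 * ?t + 1 - y) \<in> ?s"
        by (auto intro: lower outer)
      then have "(x, 4 * ?t + 1 - x) \<in> chained ?s"
        "(4 * ?t + 1 - x, 4 * ?t + 1 - y) \<in> chained ?s" "(4 * ?t + 1 - y, y) \<in> chained ?s"
        by auto
      then show ?thesis
        by (meson rtrancl_trans)
    qed
  qed
  show "?g x \<in> {1..2 * ?t} \<and> (x, ?g x) \<in> chained ?s"
    if "x \<in> {1..2 * rainbow_total (Suc n) ?a}" for x
  proof (cases "x \<le> 2 * ?t")
    case False
    then have "(4 * ?t + 1 - x, x) \<in> ?s"
      using that by (intro lower) (auto simp: total)
    then show ?thesis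
      using that False by (auto simp: total)
  qed (use that in auto)
  show "?g x = x" if "x \<in> {1..2 * ?t}" for x
    using that by simp
  show "(?g x, ?g y) \<in> chained (meander_arcs n a)" if "(x, y) \<in> ?s" for x y
  proof -
    \<comment> \<open>Under \<open>?g\<close> an old upper arc stays fixed, an arc of the new family
      becomes a reversed old lower arc, and a new lower arc collapses to a point.\<close>
    consider "(x, y) \<in> upper_arcs n a"
      | i where "i \<in> {1..?t}" "x = 2 * ?t + i" "y = 4 * ?t + 1 - i"
      | k where "k \<in> {1..2 * ?t}" "x = k" "y = 4 * ?t + 1 - k"
      using \<open>(x, y) \<in> ?s\<close>
      by (auto simp: meander_arcs_def lower_arcs_def total upper_arcs_append)
    then show ?thesis
    proof cases
      case 1
      then show ?thesis
        using upper_arcs_range[OF 1] by (auto simp: meander_arcs_def)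
    next
      case 2
      then have "?g x = 2 * ?t + 1 - i" "?g y = i"
        by auto
      moreover have "(i, 2 * ?t + 1 - i) \<in> meander_arcs n a"
        using 2 by (auto simp: meander_arcs_def lower_arcs_def)
      ultimately show ?thesis
        by auto
    next
      case 3
      then show ?thesis by auto
    qed
  qed
qed

section \<open>Two small meanders, counted explicitly\<close>

lemma lower_arcs_image:
  "lower_arcs n a = (\<lambda>k. (k, 2 * rainbow_total n a + 1 - k)) ` {1..rainbow_total n a}"
  by (auto simp: lower_arcs_def)

lemma chained_step: "(x, y) \<in> s \<or> (y, x) \<in> s \<Longrightarrow> (y, z) \<in> chained s \<Longrightarrow> (x, z) \<in> chained s"
  by (rule converse_rtrancl_into_rtrancl) auto

lemma numeral_intervals:
  "{Suc 0..2} = {1, 2}" "{Suc 0..3} = {1, 2, 3}" "{Suc 0..4} = {1, 2, 3, 4}"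
  "{Suc 0..5} = {1, 2, 3, 4, 5}" "{Suc 0..8} = {1, 2, 3, 4, 5, 6, 7, 8}"
  "{Suc 0..10} = {1, 2, 3, 4, 5, 6, 7, 8, 9, 10}"
  "{Suc 0..<2} = {1}" "{Suc 0..<3} = {1, 2}" "{Suc 0..<4} = {1, 2, 3}"
  by (auto simp: eval_nat_numeral atLeastAtMostSuc_conv atLeastLessThanSuc)

lemma components_1_2_1: "meander_components 3 ((\<lambda>_. 0)(1 := 1, 2 := 2, 3 := 1)) = 3"
proof -
  let ?a = "(\<lambda>_. 0)(1 := 1, 2 := 2, 3 := 1) :: nat \<Rightarrow> nat"
  \<comment> \<open>The curves are {1,2,7,8}, {3,6} and {4,5}; each point is sent to the least point
    of its curve.\<close>
  let ?g = "(\<lambda>x. if x \<in> {3,6} then 3 else if x \<in> {4,5} then 4 else 1) :: nat \<Rightarrow> nat"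
  define s :: "nat rel" where "s = {(1,2), (3,6), (4,5), (7,8), (1,8), (2,7)}"
  have total: "rainbow_total 3 ?a = 4"
    by (simp add: rainbow_total_def numeral_intervals)
  have arcs: "meander_arcs 3 ?a = s"
    unfolding s_def meander_arcs_def upper_arcs_UN lower_arcs_image total
    by (simp add: rainbow_shift_def numeral_intervals set_eq_subset)
  have "(2, 1) \<in> chained s" "(8, 1) \<in> chained s" "(6, 3) \<in> chained s" "(5, 4) \<in> chained s"
    by (rule chained_step[OF _ rtrancl_refl]; simp add: s_def)+
  moreover from this have "(7, 1) \<in> chained s"
    by (intro chained_step[of 7 8]) (simp_all add: s_def)
  ultimately have "?g x \<in> {1,3,4} \<and> (x, ?g x) \<in> chained s" if "x \<in> {1..8}" for x
    using that by (auto simp: numeral_intervals)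
  then have "card ({1..8} // chained s) = card {1, 3, 4::nat}"
    by (rule card_quotient_representatives[where g = ?g, rotated]) (auto simp: s_def)
  then show ?thesis
    unfolding meander_components_def meander_curves_def arcs total by simp
qed

lemma components_1_2_1_1:
  "meander_components 4 ((\<lambda>_. 0)(1 := 1, 2 := 2, 3 := 1, 4 := 1)) = 2"
proof -
  let ?a = "(\<lambda>_. 0)(1 := 1, 2 := 2, 3 := 1, 4 := 1) :: nat \<Rightarrow> nat"
  \<comment> \<open>The curves are {1,2,9,10} and {3,...,8}, represented by their least
    points.\<close>
  let ?g = "(\<lambda>x. if x \<in> {1,2,9,10} then 1 else 3) :: nat \<Rightarrow> nat"
  define s :: "nat rel" where
    "s = {(1,2), (3,6), (4,5), (7,8), (9,10), (1,10), (2,9), (3,8), (4,7), (5,6)}"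
  have total: "rainbow_total 4 ?a = 5"
    by (simp add: rainbow_total_def numeral_intervals)
  have arcs: "meander_arcs 4 ?a = s"
    unfolding s_def meander_arcs_def upper_arcs_UN lower_arcs_image total
    by (simp add: rainbow_shift_def numeral_intervals set_eq_subset)
  \<comment> \<open>Points are linked to their representatives by increasing distance: one arc, then
    two, and finally three for the point 4.\<close>
  have 1: "(2, 1) \<in> chained s" "(10, 1) \<in> chained s" "(6, 3) \<in> chained s" "(8, 3) \<in> chained s"
    by (rule chained_step[OF _ rtrancl_refl]; simp add: s_def)+
  have 2: "(9, 1) \<in> chained s" "(5, 3) \<in> chained s" "(7, 3) \<in> chained s"
    using chained_step[OF _ 1(2), of 9] chained_step[OF _ 1(3), of 5] chained_step[OF _ 1(4), of 7]
    by (simp_all add: s_def)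
  have "(4, 3) \<in> chained s"
    using chained_step[OF _ 2(2), of 4] by (simp add: s_def)
  with 1 2 have "?g x \<in> {1,3} \<and> (x, ?g x) \<in> chained s" if "x \<in> {1..10}" for x
    using that by (auto simp: numeral_intervals)
  then have "card ({1..10} // chained s) = card {1, 3::nat}"
    by (rule card_quotient_representatives[where g = ?g, rotated]) (auto simp: s_def)
  then show ?thesis
    unfolding meander_components_def meander_curves_def arcs total by simp
qed

section \<open>The obstruction modulo 3 and its conflict with polynomial values\<close>

lemma components_not_congruent:
  assumes "n \<ge> 4"
  shows "\<exists>a b :: nat \<Rightarrow> nat. (\<forall>l\<in>{1..n}. 0 < a l \<and> 0 < b l \<and> [a l = b l] (mod 3)) \<and>
    3 dvd meander_components n a \<and> \<not> 3 dvd meander_components n b"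
  using assms
proof (induction n rule: dec_induct)
  case base
  let ?c = "(\<lambda>_. 0)(1 := 1, 2 := 2, 3 := 1) :: nat \<Rightarrow> nat"
  \<comment> \<open>The entry 4 is the total of (1, 2, 1), so \<open>?a\<close> inherits its 3
    curves; the entry 1 in \<open>?b\<close> is congruent to 4 modulo 3 but gives 2 curves.\<close>
  let ?a = "?c(4 := 4)"
  let ?b = "?c(4 := 1)"
  have "rainbow_total 3 ?c = 4"
    by (simp add: rainbow_total_def numeral_intervals)
  then have "3 dvd meander_components 4 ?a"
    using meander_components_append_total[of 3 ?c] by (simp add: components_1_2_1[simplified])
  moreover have "\<not> 3 dvd meander_components 4 ?b"
    unfolding components_1_2_1_1 by simp
  moreover have "\<forall>l\<in>{1..4}. 0 < ?a l \<and> 0 < ?b l \<and> [?a l = ?b l] (mod 3)"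
    by (auto simp: numeral_intervals cong_def)
  ultimately show ?case
    by blast
next
  case (step n)
  then obtain a b where pos: "\<forall>l\<in>{1..n}. 0 < a l \<and> 0 < b l \<and> [a l = b l] (mod 3)"
    and comp: "3 dvd meander_components n a" "\<not> 3 dvd meander_components n b"
    by blast
  \<comment> \<open>The appended entries are the totals of \<open>a\<close> and of \<open>b\<close>;
    they are congruent as sums of congruent entries, and the curve counts do not change.\<close>
  have "[rainbow_total n a = rainbow_total n b] (mod 3)"
    unfolding rainbow_total_def using pos by (intro cong_sum) auto
  moreover have "0 < rainbow_total n a" "0 < rainbow_total n b"
    unfolding rainbow_total_def using pos \<open>4 \<le> n\<close> by (auto intro!: sum_pos)
  ultimately have "\<forall>l\<in>{1..Suc n}. 0 < (a(Suc n := rainbow_total n a)) l \<and>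
      0 < (b(Suc n := rainbow_total n b)) l \<and>
      [(a(Suc n := rainbow_total n a)) l = (b(Suc n := rainbow_total n b)) l] (mod 3)"
    using pos by (simp add: atLeastAtMostSuc_conv)
  with comp show ?case
    using meander_components_append_total by metis
qed

text \<open>Sums, products and powers respect congruence, and \<open>mpolys n\<close> confines the
  variables to the indices where congruence is assumed.\<close>

lemma cong_mpoly_eval:
  assumes "f \<in> mpolys n" and "\<And>l. l \<in> {1..n} \<Longrightarrow> [x l = y l] (mod N)"
  shows "[mpoly_eval f x = mpoly_eval f y] (mod N)"
  unfolding mpoly_eval_def
proof (intro cong_sum cong_scalar_left cong_prod cong_pow)
  fix m :: "nat \<Rightarrow>\<^sub>0 nat" and i
  assume "m \<in> Poly_Mapping.keys f" "i \<in> Poly_Mapping.keys m"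
  then have "i \<in> {1..n}"
    using assms(1) unfolding mpolys_def by blast
  then show "[x i = y i] (mod N)"
    by (rule assms(2))
qed

theorem theorem5p3:
  fixes n :: nat
  assumes "n \<ge> 4"
  shows "\<not> (\<exists>f1 \<in> mpolys n. \<exists>f2 \<in> mpolys n.
            homogeneous f1 \<and> homogeneous f2 \<and>
            (\<forall>a :: nat \<Rightarrow> nat. (\<forall>l \<in> {1..n}. 0 < a l) \<longrightarrow>
               int (meander_components n a) =
                 gcd (mpoly_eval f1 (\<lambda>l. int (a l))) (mpoly_eval f2 (\<lambda>l. int (a l)))))"
proof
  assume "\<exists>f1 \<in> mpolys n. \<exists>f2 \<in> mpolys n.
            homogeneous f1 \<and> homogeneous f2 \<and>
            (\<forall>a :: nat \<Rightarrow> nat. (\<forall>l \<in> {1..n}. 0 < a l) \<longrightarrow>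
               int (meander_components n a) =
                 gcd (mpoly_eval f1 (\<lambda>l. int (a l))) (mpoly_eval f2 (\<lambda>l. int (a l))))"
  then obtain f1 f2 where f: "f1 \<in> mpolys n" "f2 \<in> mpolys n"
    and gcd: "\<And>a :: nat \<Rightarrow> nat. \<forall>l \<in> {1..n}. 0 < a l \<Longrightarrow> int (meander_components n a) =
      gcd (mpoly_eval f1 (\<lambda>l. int (a l))) (mpoly_eval f2 (\<lambda>l. int (a l)))"
    by blast
  obtain a b :: "nat \<Rightarrow> nat"
    where ab: "\<forall>l\<in>{1..n}. 0 < a l \<and> 0 < b l \<and> [a l = b l] (mod 3)"
      and comp: "3 dvd meander_components n a" "\<not> 3 dvd meander_components n b"
    using components_not_congruent[OF assms] by blast
  have "[int (a l) = int (b l)] (mod 3)" if "l \<in> {1..n}" for l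
    using ab that cong_int_iff[of "a l" "b l" 3] by simp
  then have dvd_iff: "3 dvd mpoly_eval f (\<lambda>l. int (a l)) \<longleftrightarrow> 3 dvd mpoly_eval f (\<lambda>l. int (b l))"
    if "f \<in> mpolys n" for f
    using that by (intro cong_dvd_iff cong_mpoly_eval)
  \<comment> \<open>A gcd is divisible by 3 iff both arguments are, and \<open>dvd_iff\<close>
    transfers this for each polynomial from \<open>a\<close> to \<open>b\<close>.\<close>
  have "3 dvd int (meander_components n a) \<longleftrightarrow> 3 dvd int (meander_components n b)"
    using ab dvd_iff[OF f(1)] dvd_iff[OF f(2)] by (simp add: gcd)
  with comp show False
    using int_dvd_int_iff[of 3] by simp
qed

end
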